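(* Consider two consecutive time periods $t-1$ and $t$. Let $X$ be the set of all $(p_{t-1},p_t,u_{t-1},u_t)$ with $p_{t-1},p_t\ge 0$, $u_{t-1},u_t\in\{0,1\}$ and $$\underline P\,u_s\le p_s\le\overline P\,u_s\quad(s\in\{t-1,t\}),$$ $$p_t-p_{t-1}\le(\underline P+\overline R^{\mathrm{up}})u_t-\underline P u_{t-1},\qquad p_{t-1}-p_t\le(\underline P+\overline R^{\mathrm{dn}})u_{t-1}-\underline P u_t .$$ Then the following linear inequalities are necessary and sufficient to describe the convex hull of $X$: $$\underline P\,u_s\le p_s\le\overline P\,u_s,\qquad u_s\le 1\qquad(s\in\{t-1,t\}),$$ $$p_t-p_{t-1}\le(\underline P+\overline R^{\mathrm{up}})u_t-\underline P u_{t-1},\qquad p_{t-1}-p_t\le(\underline P+\overline R^{\mathrm{dn}})u_{t-1}-\underline P u_t,$$ $$p_t\le(\underline P+\overline R^{\mathrm{up}})u_t+(\overline P-\underline P-\overline R^{\mathrm{up}})u_{t-1},\qquad p_{t-1}\le(\underline P+\overline R^{\mathrm{dn}})u_{t-1}+(\overline P-\underline P-\overline R^{\mathrm{dn}})u_t .$$ That is, the convex hull of $X$ is exactly the set of real $(p_{t-1},p_t,u_{t-1},u_t)$ satisfying all these inequalities (sufficiency), and none of these inequalities is redundant (necessity).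
   Context: Single-unit, two-period unit commitment problem with ramping up and down, without a demand balance constraint. Here $p_s$ is the production of the unit in period $s$ and $u_s$ its commitment (up/down) status. Parameters: $\underline P$ and $\overline P$ are the minimum and maximum output of the unit in one period when it is up; $\overline R^{\mathrm{up}}$ and $\overline R^{\mathrm{dn}}$ are the maximum amounts by which it can ramp its output up and down in one period. An inequality in a list is redundant if deleting it does not change the solution set of the list.
   Formalization: The formal theorem assumes minimum output ≥ 0, both ramp limits > 0, and minimum output plus each ramp limit strictly below maximum output; without these the claim fails (an inequality becomes redundant, or the list does not describe the hull). *)

theory Defs
  imports "HOL-Analysis.Analysis"
begin

text \<open>Coordinates are \<open>(p, p', u, u')\<close>: production and commitment status in period \<open>t-1\<close>
  (unprimed) and in period \<open>t\<close> (primed).\<close>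

type_synonym point = "real \<times> real \<times> real \<times> real"

definition uc_set :: "real \<Rightarrow> real \<Rightarrow> real \<Rightarrow> real \<Rightarrow> point set" where
  "uc_set Pmin Pmax Rup Rdn =
    {(p, p', u, u').
       0 \<le> p \<and> 0 \<le> p' \<and> u \<in> {0, 1} \<and> u' \<in> {0, 1} \<and>
       Pmin * u \<le> p \<and> p \<le> Pmax * u \<and>
       Pmin * u' \<le> p' \<and> p' \<le> Pmax * u' \<and>
       p' - p \<le> (Pmin + Rup) * u' - Pmin * u \<and>
       p - p' \<le> (Pmin + Rdn) * u - Pmin * u'}"

text \<open>Each two-sided bound \<open>Pmin * u \<le> p \<le> Pmax * u\<close> counts as two inequalities.\<close>

definition uc_hull_ineqs :: "real \<Rightarrow> real \<Rightarrow> real \<Rightarrow> real \<Rightarrow> (point \<Rightarrow> bool) list" where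
  "uc_hull_ineqs Pmin Pmax Rup Rdn =
    [\<lambda>(p, p', u, u'). Pmin * u \<le> p,
     \<lambda>(p, p', u, u'). p \<le> Pmax * u,
     \<lambda>(p, p', u, u'). Pmin * u' \<le> p',
     \<lambda>(p, p', u, u'). p' \<le> Pmax * u',
     \<lambda>(p, p', u, u'). u \<le> 1,
     \<lambda>(p, p', u, u'). u' \<le> 1,
     \<lambda>(p, p', u, u'). p' - p \<le> (Pmin + Rup) * u' - Pmin * u,
     \<lambda>(p, p', u, u'). p - p' \<le> (Pmin + Rdn) * u - Pmin * u',
     \<lambda>(p, p', u, u'). p' \<le> (Pmin + Rup) * u' + (Pmax - Pmin - Rup) * u,
     \<lambda>(p, p', u, u'). p \<le> (Pmin + Rdn) * u + (Pmax - Pmin - Rdn) * u']"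

definition solution_set :: "('a \<Rightarrow> bool) list \<Rightarrow> 'a set" where
  "solution_set cs = {x. \<forall>c \<in> set cs. c x}"

text \<open>Redundancy refers to a position in the list, so that an inequality occurring twice is
  redundant at either position.\<close>

definition redundant :: "('a \<Rightarrow> bool) list \<Rightarrow> nat \<Rightarrow> bool" where
  "redundant cs i \<longleftrightarrow> solution_set (take i cs @ drop (Suc i) cs) = solution_set cs"

end

theory Submission
  imports Defs
begin

text \<open>
  Write \<open>m, M, U, D\<close> for \<open>Pmin, Pmax, Rup, Rdn\<close>. The set \<open>X\<close> is a union of four polytopes, one
  for each commitment pattern \<open>(u, u')\<close>: the origin for \<open>(0,0)\<close>, the segment \<open>m \<le> p' \<le> m + U\<close> for
  \<open>(0,1)\<close>, the segment \<open>m \<le> p \<le> m + D\<close> for \<open>(1,0)\<close>, and a polygon for \<open>(1,1)\<close>.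

  Sufficiency: a point of the convex hull mixes these four pieces with weights that sum to 1 and
  give the commitments \<open>u\<close> and \<open>u'\<close>. For \<open>u \<le> u'\<close> it is enough to consider mixtures without the
  pattern \<open>(1,0)\<close>, which forces the weights \<open>1 - u'\<close>, \<open>u' - u\<close>, \<open>u\<close> for \<open>(0,0)\<close>, \<open>(0,1)\<close>, \<open>(1,1)\<close>.
  All of \<open>p\<close> then comes from the pattern \<open>(1,1)\<close>, and the only unknown is the part \<open>r\<close> of \<open>p'\<close> that
  comes from it. The requirements on \<open>r\<close> are three lower and three upper bounds, and the nine
  conditions that a lower bound does not exceed an upper one all follow from the listed
  inequalities (Fourier-Motzkin elimination of \<open>r\<close>); the ramping inequalities and the strengthened
  upper bound on \<open>p'\<close> are exactly what this elimination produces. This is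
  \<open>ineqs_imp_hull_ordered\<close>. The case \<open>u' \<le> u\<close> is its mirror image under the exchange of the two
  periods, which also exchanges \<open>U\<close> and \<open>D\<close>.

  Necessity: for each inequality there is a point that violates it and satisfies the other nine.
\<close>

section \<open>The inequalities are valid on the hull\<close>

lemma convex_solution_set:
  fixes cs :: "('a::real_vector \<Rightarrow> bool) list"
  assumes "\<And>c. c \<in> set cs \<Longrightarrow> convex {x. c x}"
  shows "convex (solution_set cs)"
proof -
  have "solution_set cs = (\<Inter>c\<in>set cs. {x. c x})"
    by (auto simp: solution_set_def)
  then show ?thesis
    using assms by (auto intro: convex_INT)
qed

lemma convex_linear_inequality:
  fixes c :: "point \<Rightarrow> bool"
  assumes "\<And>p p' u u'. c (p, p', u, u') \<longleftrightarrow> \<alpha> * p + \<beta> * p' + \<gamma> * u + \<delta> * u' \<le> \<epsilon>"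
  shows "convex {x. c x}"
proof -
  have "{x. c x} = {x. inner (\<alpha>, \<beta>, \<gamma>, \<delta>) x \<le> \<epsilon>}"
    by (auto simp: assms inner_prod_def algebra_simps)
  then show ?thesis
    by (simp add: convex_halfspace_le)
qed

lemma convex_solution_set_uc_hull_ineqs:
  "convex (solution_set (uc_hull_ineqs Pmin Pmax Rup Rdn))"
proof (rule convex_solution_set)
  fix c assume "c \<in> set (uc_hull_ineqs Pmin Pmax Rup Rdn)"
  then consider
      "c = (\<lambda>(p, p', u, u'). Pmin * u \<le> p)"
    | "c = (\<lambda>(p, p', u, u'). p \<le> Pmax * u)"
    | "c = (\<lambda>(p, p', u, u'). Pmin * u' \<le> p')"
    | "c = (\<lambda>(p, p', u, u'). p' \<le> Pmax * u')"
    | "c = (\<lambda>(p, p', u, u'). u \<le> 1)"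
    | "c = (\<lambda>(p, p', u, u'). u' \<le> 1)"
    | "c = (\<lambda>(p, p', u, u'). p' - p \<le> (Pmin + Rup) * u' - Pmin * u)"
    | "c = (\<lambda>(p, p', u, u'). p - p' \<le> (Pmin + Rdn) * u - Pmin * u')"
    | "c = (\<lambda>(p, p', u, u'). p' \<le> (Pmin + Rup) * u' + (Pmax - Pmin - Rup) * u)"
    | "c = (\<lambda>(p, p', u, u'). p \<le> (Pmin + Rdn) * u + (Pmax - Pmin - Rdn) * u')"
    unfolding uc_hull_ineqs_def by auto
  then show "convex {x. c x}"
  proof cases
    case 1
    then show ?thesis
      by (intro convex_linear_inequality[of _ "-1" 0 Pmin 0 0]) (auto simp: algebra_simps)
  next
    case 2
    then show ?thesis
      by (intro convex_linear_inequality[of _ 1 0 "-Pmax" 0 0]) (auto simp: algebra_simps)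
  next
    case 3
    then show ?thesis
      by (intro convex_linear_inequality[of _ 0 "-1" 0 Pmin 0]) (auto simp: algebra_simps)
  next
    case 4
    then show ?thesis
      by (intro convex_linear_inequality[of _ 0 1 0 "-Pmax" 0]) (auto simp: algebra_simps)
  next
    case 5
    then show ?thesis
      by (intro convex_linear_inequality[of _ 0 0 1 0 1]) auto
  next
    case 6
    then show ?thesis
      by (intro convex_linear_inequality[of _ 0 0 0 1 1]) auto
  next
    case 7
    then show ?thesis
      by (intro convex_linear_inequality[of _ "-1" 1 Pmin "-(Pmin + Rup)" 0])
         (auto simp: algebra_simps)
  next
    case 8
    then show ?thesis
      by (intro convex_linear_inequality[of _ 1 "-1" "-(Pmin + Rdn)" Pmin 0])
         (auto simp: algebra_simps)
  next
    case 9
    then show ?thesis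
      by (intro convex_linear_inequality[of _ 0 1 "-(Pmax - Pmin - Rup)" "-(Pmin + Rup)" 0])
         (auto simp: algebra_simps)
  next
    case 10
    then show ?thesis
      by (intro convex_linear_inequality[of _ 1 0 "-(Pmin + Rdn)" "-(Pmax - Pmin - Rdn)" 0])
         (auto simp: algebra_simps)
  qed
qed

lemma mem_solution_set_uc_hull_ineqs:
  "(p, p', u, u') \<in> solution_set (uc_hull_ineqs Pmin Pmax Rup Rdn) \<longleftrightarrow>
     Pmin * u \<le> p \<and> p \<le> Pmax * u \<and> Pmin * u' \<le> p' \<and> p' \<le> Pmax * u' \<and> u \<le> 1 \<and> u' \<le> 1 \<and>
     p' - p \<le> (Pmin + Rup) * u' - Pmin * u \<and> p - p' \<le> (Pmin + Rdn) * u - Pmin * u' \<and>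
     p' \<le> (Pmin + Rup) * u' + (Pmax - Pmin - Rup) * u \<and>
     p \<le> (Pmin + Rdn) * u + (Pmax - Pmin - Rdn) * u'"
  by (simp add: solution_set_def uc_hull_ineqs_def)

lemma uc_set_subset_solution_set:
  assumes "Pmin + Rup \<le> Pmax" and "Pmin + Rdn \<le> Pmax"
  shows "uc_set Pmin Pmax Rup Rdn \<subseteq> solution_set (uc_hull_ineqs Pmin Pmax Rup Rdn)"
  using assms by (auto simp: uc_set_def mem_solution_set_uc_hull_ineqs)

section \<open>The inequalities suffice\<close>

text \<open>The weight of a pattern may be zero, so the share \<open>y\<close> that the pattern contributes cannot
  always be divided by its weight \<open>t\<close>. If \<open>t = 0\<close>, the bounds force \<open>y = 0\<close>, and any admissible
  production serves as \<open>z\<close>.\<close>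

lemma rescale_to_segment:
  fixes l h t y :: real
  assumes "0 \<le> t" "l \<le> h" "l * t \<le> y" "y \<le> h * t"
  obtains z where "l \<le> z" "z \<le> h" "y = t * z"
proof (cases "t = 0")
  case True
  then show ?thesis
    using assms that[of l] by simp
next
  case False
  then show ?thesis
    using assms that[of "y / t"] by (simp add: field_simps)
qed

lemma rescale_to_ramp_polygon:
  fixes m M U D t y y' :: real
  assumes "0 \<le> t" "m \<le> M" "0 \<le> U" "0 \<le> D"
    and "m * t \<le> y" "y \<le> M * t" "m * t \<le> y'" "y' \<le> M * t"
    and "y' - y \<le> U * t" "y - y' \<le> D * t"
  obtains z z' where "m \<le> z" "z \<le> M" "m \<le> z'" "z' \<le> M" "z' - z \<le> U" "z - z' \<le> D"
    and "y = t * z" "y' = t * z'"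
proof (cases "t = 0")
  case True
  then show ?thesis
    using assms that[of m m] by simp
next
  case False
  have "y' / t - y / t \<le> U" "y / t - y' / t \<le> D"
    using False assms by (simp_all add: field_simps flip: diff_divide_distrib)
  then show ?thesis
    using False assms that[of "y / t" "y' / t"] by (simp add: field_simps)
qed

lemma ineqs_imp_hull_ordered:
  assumes Pmin: "0 \<le> Pmin" and Rup: "0 < Rup" and Rdn: "0 < Rdn" and "Pmin + Rup \<le> Pmax"
    and sol: "(p, p', u, u') \<in> solution_set (uc_hull_ineqs Pmin Pmax Rup Rdn)"
    and "u \<le> u'"
  shows "(p, p', u, u') \<in> convex hull (uc_set Pmin Pmax Rup Rdn)"
proof -
  have "Pmin < Pmax"
    using Rup \<open>Pmin + Rup \<le> Pmax\<close> by simp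
  note ineqs = sol[unfolded mem_solution_set_uc_hull_ineqs]
  have "0 \<le> (Pmax - Pmin) * u"
    using ineqs by (simp add: algebra_simps)
  then have u: "0 \<le> u"
    using \<open>Pmin < Pmax\<close> by (simp add: zero_le_mult_iff)
  have mult_u: "Pmin * u \<le> Pmax * u" "0 \<le> Rup * u" "0 \<le> Rdn * u"
    using u Rup Rdn \<open>Pmin < Pmax\<close> by (auto intro: mult_right_mono)
  \<comment> \<open>The largest of the three lower bounds on the share of \<open>p'\<close> from the pattern \<open>(1,1)\<close>.\<close>
  define r where "r = max (p' - (Pmin + Rup) * (u' - u)) (max (Pmin * u) (p - Rdn * u))"
  have r_lower: "p' - (Pmin + Rup) * (u' - u) \<le> r" "Pmin * u \<le> r" "p - Rdn * u \<le> r"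
    unfolding r_def by auto
  have r_upper: "r \<le> p' - Pmin * (u' - u)" "r \<le> Pmax * u" "r \<le> p + Rup * u"
  proof -
    have "0 \<le> Rup * (u' - u)"
      using Rup \<open>u \<le> u'\<close> by simp
    then show "r \<le> p' - Pmin * (u' - u)"
      unfolding r_def using ineqs by (intro max.boundedI) (simp_all add: algebra_simps)
    show "r \<le> Pmax * u"
      unfolding r_def using ineqs mult_u by (intro max.boundedI) (simp_all add: algebra_simps)
    show "r \<le> p + Rup * u"
      unfolding r_def using ineqs mult_u by (intro max.boundedI) (simp_all add: algebra_simps)
  qed
  obtain q where q: "Pmin \<le> q" "q \<le> Pmin + Rup" "p' - r = (u' - u) * q"
    using \<open>u \<le> u'\<close> Rup r_lower r_upper
    by (rule_tac rescale_to_segment[of "u' - u" Pmin "Pmin + Rup" "p' - r"]) auto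
  obtain z z' where z: "Pmin \<le> z" "z \<le> Pmax" "Pmin \<le> z'" "z' \<le> Pmax" "z' - z \<le> Rup" "z - z' \<le> Rdn"
    and share: "p = u * z" "r = u * z'"
    using u Rup Rdn \<open>Pmin < Pmax\<close> ineqs r_lower r_upper
    by (rule_tac rescale_to_ramp_polygon[of u Pmin Pmax Rup Rdn p r]) auto
  have vertices: "{(0, 0, 0, 0), (0, q, 0, 1), (z, z', 1, 1)} \<subseteq> uc_set Pmin Pmax Rup Rdn"
    using q z Pmin Rup Rdn \<open>Pmin + Rup \<le> Pmax\<close> by (auto simp: uc_set_def)
  have "(p, p', u, u') =
      (1 - u') *\<^sub>R (0, 0, 0, 0) + (u' - u) *\<^sub>R (0, q, 0, 1) + u *\<^sub>R (z, z', 1, 1)"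
    using q(3) share by simp
  moreover have "0 \<le> 1 - u'" "0 \<le> u' - u" "(1 - u') + (u' - u) + u = 1"
    using ineqs \<open>u \<le> u'\<close> by auto
  ultimately have "(p, p', u, u') \<in> convex hull {(0, 0, 0, 0), (0, q, 0, 1), (z, z', 1, 1)}"
    unfolding convex_hull_3 using u by blast
  then show ?thesis
    using hull_mono[OF vertices] by blast
qed

section \<open>Exchanging the two periods\<close>

definition swap_periods :: "point \<Rightarrow> point" where
  "swap_periods = (\<lambda>(p, p', u, u'). (p', p, u', u))"

lemma swap_periods_simp [simp]: "swap_periods (p, p', u, u') = (p', p, u', u)"
  by (simp add: swap_periods_def)

lemma linear_swap_periods: "linear swap_periods"
  by (rule linearI) (auto simp: swap_periods_def)

lemma swap_periods_uc_set:
  "swap_periods ` uc_set Pmin Pmax Rup Rdn \<subseteq> uc_set Pmin Pmax Rdn Rup"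
  by (auto simp: uc_set_def)

lemma ineqs_imp_hull:
  assumes "0 \<le> Pmin" and "0 < Rup" and "0 < Rdn"
    and "Pmin + Rup \<le> Pmax" and "Pmin + Rdn \<le> Pmax"
    and sol: "(p, p', u, u') \<in> solution_set (uc_hull_ineqs Pmin Pmax Rup Rdn)"
  shows "(p, p', u, u') \<in> convex hull (uc_set Pmin Pmax Rup Rdn)"
proof (cases "u \<le> u'")
  case True
  with assms show ?thesis
    by (blast intro: ineqs_imp_hull_ordered)
next
  case False
  have "(p', p, u', u) \<in> solution_set (uc_hull_ineqs Pmin Pmax Rdn Rup)"
    using sol by (auto simp: mem_solution_set_uc_hull_ineqs)
  then have "(p', p, u', u) \<in> convex hull (uc_set Pmin Pmax Rdn Rup)"
    using False assms by (intro ineqs_imp_hull_ordered) auto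
  then have "swap_periods (p', p, u', u) \<in> convex hull (swap_periods ` uc_set Pmin Pmax Rdn Rup)"
    unfolding convex_hull_linear_image[OF linear_swap_periods, symmetric] by (rule imageI)
  then show ?thesis
    using hull_mono[OF swap_periods_uc_set[of Pmin Pmax Rdn Rup], of convex] by auto
qed

section \<open>No inequality is redundant\<close>

lemma not_redundantI:
  assumes "i < length cs" and "\<not> (cs ! i) x"
    and "\<And>c. c \<in> set (take i cs @ drop (Suc i) cs) \<Longrightarrow> c x"
  shows "\<not> redundant cs i"
proof
  assume "redundant cs i"
  moreover have "x \<in> solution_set (take i cs @ drop (Suc i) cs)"
    unfolding solution_set_def using assms(3) by blast
  ultimately have "x \<in> solution_set cs"
    by (simp add: redundant_def)
  then show False
    using nth_mem[OF assms(1)] assms(2) unfolding solution_set_def by blast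
qed

text \<open>
  For the first eight inequalities a witness can be found by keeping commitments integral and
  moving past the bound. At a point with \<open>u = u' = 1\<close> the strengthened bound on \<open>p'\<close> coincides with
  \<open>p' \<le> M\<close>, and for the integral choices with \<open>u = 0\<close> or \<open>u' = 0\<close> it follows from the other
  inequalities. Its witness is therefore taken near the midpoint of the vertices
  \<open>(0, m + U, 0, 1)\<close> and \<open>(M - U, M, 1, 1)\<close> at which it is tight: both productions of the midpoint
  are raised by half of \<open>\<delta>\<close>, where \<open>\<delta> \<le> U\<close> keeps \<open>p \<le> M * u\<close> and \<open>\<delta> \<le> M - m - U\<close>
  keeps \<open>p' \<le> M * u'\<close>. Raising both by the same amount leaves the ramping inequalities intact.
\<close>

lemma uc_hull_ineqs_irredundant:
  assumes "0 \<le> Pmin" and "0 < Rup" and "0 < Rdn"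
    and "Pmin + Rup < Pmax" and "Pmin + Rdn < Pmax"
    and "i < length (uc_hull_ineqs Pmin Pmax Rup Rdn)"
  shows "\<not> redundant (uc_hull_ineqs Pmin Pmax Rup Rdn) i"
proof -
  have violated_only: "\<not> redundant (uc_hull_ineqs Pmin Pmax Rup Rdn) i"
    if "\<not> (uc_hull_ineqs Pmin Pmax Rup Rdn ! i) x"
      and "\<forall>c \<in> set (take i (uc_hull_ineqs Pmin Pmax Rup Rdn) @
                 drop (Suc i) (uc_hull_ineqs Pmin Pmax Rup Rdn)). c x" for x
    using that not_redundantI[OF assms(6)] by blast
  note expand = uc_hull_ineqs_def algebra_simps min_def
  have "i \<in> {0, 1, 2, 3, 4, 5, 6, 7, 8, 9}"
    using assms(6) by (auto simp: uc_hull_ineqs_def)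
  then consider "i = 0" | "i = 1" | "i = 2" | "i = 3" | "i = 4" | "i = 5" | "i = 6" | "i = 7"
    | "i = 8" | "i = 9"
    by blast
  then show ?thesis
  proof cases
    case 1
    show ?thesis
      by (rule violated_only[of "(Pmin - Rup, Pmin, 1, 1)"]) (use 1 assms in \<open>auto simp: expand\<close>)
  next
    case 2
    \<comment> \<open>The idle unit produces; \<open>p'\<close> rises with \<open>p\<close> to keep the ramp-down inequality \<open>p - p' \<le> - m\<close>,
      which limits the amount by \<open>p' \<le> m + U\<close>. The strengthened bound on \<open>p\<close> limits it by \<open>M - m - D\<close>.\<close>
    show ?thesis
      by (rule violated_only[of "(min Rup (Pmax - Pmin - Rdn), Pmin + min Rup (Pmax - Pmin - Rdn), 0, 1)"])
         (use 2 assms in \<open>auto simp: expand\<close>)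
  next
    case 3
    show ?thesis
      by (rule violated_only[of "(Pmin, Pmin - Rdn, 1, 1)"]) (use 3 assms in \<open>auto simp: expand\<close>)
  next
    case 4
    show ?thesis
      by (rule violated_only[of "(Pmin + min Rdn (Pmax - Pmin - Rup), min Rdn (Pmax - Pmin - Rup), 1, 0)"])
         (use 4 assms in \<open>auto simp: expand\<close>)
  next
    case 5
    show ?thesis
      by (rule violated_only[of "(2 * Pmin, Pmin, 2, 1)"]) (use 5 assms in \<open>auto simp: expand\<close>)
  next
    case 6
    show ?thesis
      by (rule violated_only[of "(Pmin, 2 * Pmin, 1, 2)"]) (use 6 assms in \<open>auto simp: expand\<close>)
  next
    case 7
    show ?thesis
      by (rule violated_only[of "(Pmin, Pmax, 1, 1)"]) (use 7 assms in \<open>auto simp: expand\<close>)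
  next
    case 8
    show ?thesis
      by (rule violated_only[of "(Pmax, Pmin, 1, 1)"]) (use 8 assms in \<open>auto simp: expand\<close>)
  next
    case 9
    define \<delta> where "\<delta> = min Rup (Pmax - Pmin - Rup)"
    have "0 < \<delta>" "\<delta> \<le> Rup" "\<delta> \<le> Pmax - Pmin - Rup"
      using assms by (auto simp: \<delta>_def)
    then show ?thesis
      by (intro violated_only[of "((Pmax - Rup + \<delta>) / 2, (Pmax + Pmin + Rup + \<delta>) / 2, 1 / 2, 1)"])
         (use 9 assms in \<open>auto simp: uc_hull_ineqs_def field_simps\<close>)
  next
    case 10
    define \<delta> where "\<delta> = min Rdn (Pmax - Pmin - Rdn)"
    have "0 < \<delta>" "\<delta> \<le> Rdn" "\<delta> \<le> Pmax - Pmin - Rdn"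
      using assms by (auto simp: \<delta>_def)
    then show ?thesis
      by (intro violated_only[of "((Pmax + Pmin + Rdn + \<delta>) / 2, (Pmax - Rdn + \<delta>) / 2, 1, 1 / 2)"])
         (use 10 assms in \<open>auto simp: uc_hull_ineqs_def field_simps\<close>)
  qed
qed

theorem propositionA2:
  fixes Pmin Pmax Rup Rdn :: real
  assumes "0 \<le> Pmin" and "0 < Rup" and "0 < Rdn"
    and "Pmin + Rup < Pmax" and "Pmin + Rdn < Pmax"
  shows "convex hull (uc_set Pmin Pmax Rup Rdn) = solution_set (uc_hull_ineqs Pmin Pmax Rup Rdn)
    \<and> (\<forall>i < length (uc_hull_ineqs Pmin Pmax Rup Rdn). \<not> redundant (uc_hull_ineqs Pmin Pmax Rup Rdn) i)"
proof (intro conjI equalityI allI impI)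
  show "convex hull (uc_set Pmin Pmax Rup Rdn) \<subseteq> solution_set (uc_hull_ineqs Pmin Pmax Rup Rdn)"
    using assms by (intro hull_minimal uc_set_subset_solution_set convex_solution_set_uc_hull_ineqs) auto
  show "solution_set (uc_hull_ineqs Pmin Pmax Rup Rdn) \<subseteq> convex hull (uc_set Pmin Pmax Rup Rdn)"
    using assms by (auto intro!: ineqs_imp_hull)
  show "\<not> redundant (uc_hull_ineqs Pmin Pmax Rup Rdn) i"
    if "i < length (uc_hull_ineqs Pmin Pmax Rup Rdn)" for i
    using assms that by (rule uc_hull_ineqs_irredundant)
qed

end
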